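(* Let $P,Q\in\mathbb Z$ with $Q=\pm1$ and $\Delta=P^2+4Q>0$, and assume the Lucas sequence $U_n=U_n(P,Q)$ is nondegenerate. Let $k\ge2$, and assume the $abc$ conjecture over $K=\mathbb Q(\sqrt\Delta)$. Let $S$ be a finite set of rational primes. Then the set of positive integers $n$ for which $$U_n(P,Q)=e s^k$$ for some $s\in\mathbb Z_{\geq 1}$ and some $k$-th-power-free integer $e$ with $\operatorname{Supp}(e)\subseteq S$ is finite.
   Context: The Lucas sequence $U_n=U_n(P,Q)$ is defined by $U_0=0$, $U_1=1$, $U_{n+2}=PU_{n+1}+QU_n$. Let $\alpha,\beta$ be the roots of $x^2-Px-Q$. The sequence is nondegenerate if $\alpha/\beta$ is not a root of unity (then $U_n\neq0$ for $n\ge1$, and $K=\mathbb Q(\sqrt\Delta)$ is a real quadratic field). A nonzero integer $e$ (possibly negative) is $k$-th-power-free if $p^k\nmid e$ for every rational prime $p$; $\operatorname{Supp}(e)$ is the set of rational primes dividing $e$. The $abc$ conjecture over $K$: for every $\varepsilon>0$ there is a constant $C_{K,\varepsilon}$ such that for all triples $(a,b,c)$ of nonzero elements of $K$ with $a+b=c$, $$h(a:b:c)\le(1+\varepsilon)\operatorname{rad}_K(a:b:c)+C_{K,\varepsilon}.$$ Here $h(a:b:c)=\frac1{[K:\mathbb Q]}\sum_v\log\max\{|a|_v,|b|_v,|c|_v\}$, summed over all places $v$ of $K$, with absolute values normalised to satisfy the product formula ($|x|_v=|\sigma(x)|$ for a real embedding $\sigma$, $|x|_{\mathfrak p}=(N\mathfrak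 p)^{-v_{\mathfrak p}(x)}$ for a nonzero prime ideal $\mathfrak p$ of $\mathcal O_K$, $N\mathfrak p=|\mathcal O_K/\mathfrak p|$); and $\operatorname{rad}_K(a:b:c)=\frac1{[K:\mathbb Q]}\sum_{\mathfrak p\in I(a,b,c)}\log N\mathfrak p$, where $I(a,b,c)$ is the set of nonzero prime ideals $\mathfrak p$ for which $v_{\mathfrak p}(a),v_{\mathfrak p}(b),v_{\mathfrak p}(c)$ are not all equal. *)

theory Defs
  imports
    "HOL-Analysis.Infinite_Sum"
    "HOL-Algebra.QuotRing"
    "HOL-Algebra.Ideal_Product"
    "HOL-Computational_Algebra.Computational_Algebra"
begin

section \<open>Lucas sequences\<close>

fun lucas_U :: "int \<Rightarrow> int \<Rightarrow> nat \<Rightarrow> int" where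
  "lucas_U P Q 0 = 0"
| "lucas_U P Q (Suc 0) = 1"
| "lucas_U P Q (Suc (Suc n)) = P * lucas_U P Q (Suc n) + Q * lucas_U P Q n"

text \<open>The factorisation says that \<open>\<alpha>, \<beta>\<close> are the roots of \<open>x^2 - P x - Q\<close>, with multiplicity.
  The condition is symmetric in the roots. It is only used for \<open>Q \<noteq> 0\<close>, so that \<open>\<beta> \<noteq> 0\<close>.\<close>

definition lucas_nondegenerate :: "int \<Rightarrow> int \<Rightarrow> bool" where
  "lucas_nondegenerate P Q \<longleftrightarrow>
     (\<forall>\<alpha> \<beta> :: complex. [:- of_int Q, - of_int P, 1:] = [:- \<alpha>, 1:] * [:- \<beta>, 1:] \<longrightarrow>
        \<not> (\<exists>m::nat. m > 0 \<and> (\<alpha> / \<beta>) ^ m = 1))"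

definition kth_power_free :: "nat \<Rightarrow> int \<Rightarrow> bool" where
  "kth_power_free k e \<longleftrightarrow> e \<noteq> 0 \<and> (\<forall>p::nat. Factorial_Ring.prime p \<longrightarrow> \<not> int p ^ k dvd e)"

definition Supp :: "int \<Rightarrow> nat set" where
  "Supp e = {p. Factorial_Ring.prime p \<and> int p dvd e}"


section \<open>Heights and the abc conjecture over a totally real number field\<close>

text \<open>A number field is represented as a subfield \<open>K\<close> of the reals. All archimedean places are
  taken to be real, so the height below is the usual one only for totally real \<open>K\<close>, such as
  the real quadratic fields.\<close>

definition quadratic_field :: "int \<Rightarrow> real set" where
  "quadratic_field D = {of_rat x + of_rat y * sqrt (of_int D) | x y :: rat. True}"

definition real_ring :: "real set \<Rightarrow> real ring" where
  "real_ring A = \<lparr>carrier = A, mult = (*), one = 1, zero = 0, add = (+)\<rparr>"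

definition field_degree :: "real set \<Rightarrow> nat" where
  "field_degree K = vector_space.dim (\<lambda>(q::rat) (x::real). of_rat q * x) K"

definition ring_of_integers :: "real set \<Rightarrow> real ring" where
  "ring_of_integers K = real_ring {x \<in> K. algebraic_int x}"

text \<open>Extensionality makes distinct elements of this set distinct as maps on \<open>K\<close>.\<close>

definition real_embeddings :: "real set \<Rightarrow> (real \<Rightarrow> real) set" where
  "real_embeddings K = ring_hom (real_ring K) (real_ring UNIV) \<inter> extensional K"

definition nonzero_primes :: "real set \<Rightarrow> real set set" where
  "nonzero_primes K = {\<pp>. primeideal \<pp> (ring_of_integers K) \<and> \<pp> \<noteq> {0}}"

definition ideal_norm :: "real set \<Rightarrow> real set \<Rightarrow> nat" where
  "ideal_norm K \<pp> = card (carrier (ring_of_integers K Quot \<pp>))"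

definition integral_val :: "real set \<Rightarrow> real set \<Rightarrow> real \<Rightarrow> nat" where
  "integral_val K \<pp> x = (GREATEST n. x \<in> \<pp> [^]\<^bsub>ideals_set (ring_of_integers K)\<^esub> n)"

text \<open>The extension to nonzero \<open>x \<in> K\<close> by \<open>v(a/b) = v(a) - v(b)\<close>; as \<open>v\<close> is additive on nonzero
  algebraic integers, the value does not depend on the fraction chosen.\<close>

definition val :: "real set \<Rightarrow> real set \<Rightarrow> real \<Rightarrow> int" where
  "val K \<pp> x = (SOME m. \<exists>a\<in>carrier (ring_of_integers K). \<exists>b\<in>carrier (ring_of_integers K).
      a \<noteq> 0 \<and> b \<noteq> 0 \<and> x = a / b \<and> m = int (integral_val K \<pp> a) - int (integral_val K \<pp> b))"

definition abs_prime :: "real set \<Rightarrow> real set \<Rightarrow> real \<Rightarrow> real" where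
  "abs_prime K \<pp> x = real (ideal_norm K \<pp>) powi (- val K \<pp> x)"

text \<open>For nonzero \<open>a, b, c \<in> K\<close> only finitely many terms of the infinite sum are nonzero.\<close>

definition height :: "real set \<Rightarrow> real \<Rightarrow> real \<Rightarrow> real \<Rightarrow> real" where
  "height K a b c = 1 / real (field_degree K) *
     ((\<Sum>\<sigma>\<in>real_embeddings K. ln (Max {\<bar>\<sigma> a\<bar>, \<bar>\<sigma> b\<bar>, \<bar>\<sigma> c\<bar>}))
      + (\<Sum>\<^sub>\<infinity>\<pp>\<in>nonzero_primes K. ln (Max {abs_prime K \<pp> a, abs_prime K \<pp> b, abs_prime K \<pp> c})))"

definition rad_primes :: "real set \<Rightarrow> real \<Rightarrow> real \<Rightarrow> real \<Rightarrow> real set set" where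
  "rad_primes K a b c =
     {\<pp> \<in> nonzero_primes K. \<not> (val K \<pp> a = val K \<pp> b \<and> val K \<pp> b = val K \<pp> c)}"

definition rad :: "real set \<Rightarrow> real \<Rightarrow> real \<Rightarrow> real \<Rightarrow> real" where
  "rad K a b c = 1 / real (field_degree K) *
     (\<Sum>\<pp>\<in>rad_primes K a b c. ln (real (ideal_norm K \<pp>)))"

definition abc_conjecture :: "real set \<Rightarrow> bool" where
  "abc_conjecture K \<longleftrightarrow>
     (\<forall>\<epsilon>>0. \<exists>C::real. \<forall>a\<in>K. \<forall>b\<in>K. \<forall>c\<in>K. a \<noteq> 0 \<longrightarrow> b \<noteq> 0 \<longrightarrow> c \<noteq> 0 \<longrightarrow> a + b = c \<longrightarrow>
        height K a b c \<le> (1 + \<epsilon>) * rad K a b c + C)"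

end

theory Submission
  imports Defs
begin

text \<open>Write \<open>D = P\<^sup>2 + 4 Q\<close>, let \<open>\<alpha>, \<beta> = (P \<plusminus> \<surd>D) / 2\<close> and \<open>A = max \<bar>\<alpha>\<bar> \<bar>\<beta>\<bar>\<close>. Since
  \<open>\<alpha> \<beta> = - Q = \<plusminus>1\<close>, both roots are units;
  nondegeneracy excludes \<open>P = 0\<close>, so that \<open>\<bar>\<alpha>\<bar> \<noteq> \<bar>\<beta>\<bar>\<close> and \<open>A > 1\<close>, and it makes \<open>D\<close> a
  nonsquare. If \<open>U\<^sub>n = e s\<^sup>k\<close>, apply the abc
  inequality to Binet's formula \<open>\<alpha>\<^sup>n - \<beta>\<^sup>n = \<surd>D U\<^sub>n\<close>, with \<open>a = \<alpha>\<^sup>n\<close>, \<open>b = - \<beta>\<^sup>n\<close> and \<open>c = \<surd>D e s\<^sup>k\<close>.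

  The nontrivial embedding of \<open>K\<close> swaps \<open>\<alpha>\<close> and \<open>\<beta>\<close>, so each of the two archimedean terms is at least
  \<open>n ln A\<close>, and the finite places contribute nonnegative terms: after division by the degree \<open>2\<close> the
  height is at least \<open>n ln A\<close> (\<open>height_ge\<close>). A prime ideal counted in the radical contains \<open>c\<close>, and therefore the integer
  \<open>m = D (\<Prod>q\<in>S. q) s\<close>, because the prime factors of \<open>e\<close> lie in \<open>S\<close>.
  The product of the norms of the prime ideals containing \<open>m\<close> is at most a constant times \<open>m\<^sup>2\<close> (\<open>prod_ideal_norm_le\<close>), so the radical is at most \<open>ln s\<close> up to a
  constant (\<open>rad_le\<close>). Finally \<open>s\<^sup>2 \<le> s\<^sup>k \<le> \<bar>U\<^sub>n\<bar> \<le> 2 A\<^sup>n\<close> gives \<open>ln s \<le> (n ln A) / 2 + O(1)\<close>. With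
  \<open>\<epsilon> = 1/2\<close> one gets \<open>n ln A \<le> (3/4) n ln A + O(1)\<close>, which bounds \<open>n\<close>.

  Little arithmetic of the ring of integers is needed. Traces show that its elements have coordinates
  with bounded denominators, so it has finitely many residues modulo a nonzero integer; this makes
  nonzero prime ideals maximal (\<open>invertible_mod\<close>), shows that integers outside \<open>p\<close> have valuation \<open>0\<close>
  at \<open>p\<close> (\<open>val_eq_0\<close>), and combines with the Chinese remainder theorem to bound products of norms.\<close>

section \<open>The field generated by a square root\<close>

lemma quadratic_mult_expand:
  "(a + b * s) * (c + d * s) = a * c + b * d * (s * s) + (a * d + b * c) * s"
  for a b c d s :: real
  by (simp add: algebra_simps)

lemma quadratic_field_iff:
  "z \<in> quadratic_field D \<longleftrightarrow> (\<exists>x y::rat. z = of_rat x + of_rat y * sqrt (of_int D))"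
  by (auto simp: quadratic_field_def)

lemma quadratic_field_rat: "of_rat x \<in> quadratic_field D"
  unfolding quadratic_field_iff by (rule exI[of _ x], rule exI[of _ 0]) simp

lemma quadratic_field_of_int: "of_int x \<in> quadratic_field D"
  using quadratic_field_rat[of "of_int x" D] by simp

lemma quadratic_field_sqrt: "sqrt (of_int D) \<in> quadratic_field D"
  unfolding quadratic_field_iff by (rule exI[of _ 0], rule exI[of _ 1]) simp

lemma quadratic_field_add:
  assumes "z \<in> quadratic_field D" "w \<in> quadratic_field D"
  shows "z + w \<in> quadratic_field D"
proof -
  from assms obtain a b c d :: rat where
    "z = of_rat a + of_rat b * sqrt (of_int D)" "w = of_rat c + of_rat d * sqrt (of_int D)"
    unfolding quadratic_field_iff by blast
  hence "z + w = of_rat (a + c) + of_rat (b + d) * sqrt (of_int D)"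
    by (simp add: of_rat_add algebra_simps)
  thus ?thesis unfolding quadratic_field_iff by blast
qed

lemma quadratic_field_mult:
  assumes "D \<ge> 0" "z \<in> quadratic_field D" "w \<in> quadratic_field D"
  shows "z * w \<in> quadratic_field D"
proof -
  from assms obtain a b c d :: rat where
    zw: "z = of_rat a + of_rat b * sqrt (of_int D)" "w = of_rat c + of_rat d * sqrt (of_int D)"
    unfolding quadratic_field_iff by blast
  have sq: "sqrt (of_int D) * sqrt (of_int D) = of_int D"
    using assms(1) by simp
  have "z * w = of_rat a * of_rat c + of_rat b * of_rat d * (sqrt (of_int D) * sqrt (of_int D))
      + (of_rat a * of_rat d + of_rat b * of_rat c) * sqrt (of_int D)"
    unfolding zw by (rule quadratic_mult_expand)
  also have "\<dots> = of_rat (a * c + b * d * of_int D) + of_rat (a * d + b * c) * sqrt (of_int D)"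
    unfolding sq by (simp add: of_rat_add of_rat_mult)
  finally show ?thesis unfolding quadratic_field_iff by blast
qed

lemma quadratic_field_power:
  assumes "D \<ge> 0" "z \<in> quadratic_field D"
  shows "z ^ n \<in> quadratic_field D"
proof (induction n)
  case 0
  show ?case using quadratic_field_of_int[of 1 D] by simp
next
  case (Suc n)
  thus ?case using quadratic_field_mult[OF assms(1) assms(2)] by simp
qed

lemma quadratic_field_minus:
  assumes "z \<in> quadratic_field D"
  shows "- z \<in> quadratic_field D"
proof -
  from assms obtain a b :: rat where "z = of_rat a + of_rat b * sqrt (of_int D)"
    unfolding quadratic_field_iff by blast
  hence "- z = of_rat (- a) + of_rat (- b) * sqrt (of_int D)"
    by (simp add: of_rat_minus)
  thus ?thesis unfolding quadratic_field_iff by blast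
qed

text \<open>A real quadratic field \<open>\<rat>(\<surd>D)\<close>. The positive integer \<open>D\<close> is only assumed not to be
  a square; it need not be squarefree, so \<open>\<int> + \<int> \<surd>D\<close> may have large index in the
  ring of integers.\<close>

locale real_quadratic =
  fixes D :: int
  assumes D_pos: "D > 0" and sqrt_irrational: "sqrt (of_int D) \<notin> \<rat>"
begin

abbreviation r :: real where "r \<equiv> sqrt (of_int D)"
abbreviation K :: "real set" where "K \<equiv> quadratic_field D"
abbreviation integers :: "real set" where "integers \<equiv> {x \<in> K. algebraic_int x}"
abbreviation R :: "real ring" where "R \<equiv> ring_of_integers K"

lemma r_sq: "r * r = of_int D"
  using D_pos by simp

lemma representation_unique:
  assumes "of_rat x + of_rat y * r = of_rat x' + of_rat y' * r"
  shows "x = x' \<and> y = y'"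
proof -
  have eq: "of_rat (x - x') = of_rat (y' - y) * r"
    using assms by (simp add: of_rat_diff algebra_simps)
  have "y = y'"
  proof (rule ccontr)
    assume "y \<noteq> y'"
    hence "r = of_rat ((x - x') / (y' - y))"
      using eq by (simp add: of_rat_divide field_simps)
    thus False using sqrt_irrational Rats_of_rat[of "(x - x') / (y' - y)"] by metis
  qed
  thus ?thesis using eq by simp
qed

text \<open>The nontrivial automorphism \<open>x + y \<surd>D \<mapsto> x - y \<surd>D\<close>. The rational coordinates are unique,
  so the description is definite on \<open>K\<close>; off \<open>K\<close> the value is arbitrary.\<close>

definition conj :: "real \<Rightarrow> real" where
  "conj z = (THE w. \<exists>x y. z = of_rat x + of_rat y * r \<and> w = of_rat x - of_rat y * r)"

lemma conj_eq: "conj (of_rat x + of_rat y * r) = of_rat x - of_rat y * r"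
  unfolding conj_def by (rule the_equality) (use representation_unique in blast)+

lemma K_cases:
  assumes "z \<in> K"
  obtains x y where "z = of_rat x + of_rat y * r" "conj z = of_rat x - of_rat y * r"
  using assms conj_eq unfolding quadratic_field_iff by blast

lemma conj_in_K: "z \<in> K \<Longrightarrow> conj z \<in> K"
proof (erule K_cases)
  fix x y assume "conj z = of_rat x - of_rat y * r"
  hence "conj z = of_rat x + of_rat (- y) * r" by (simp add: of_rat_minus)
  thus "conj z \<in> K" unfolding quadratic_field_iff by blast
qed

lemma conj_add: 
  assumes "z \<in> K" "w \<in> K" shows "conj (z + w) = conj z + conj w"
proof -
  obtain a b c d where
    z: "z = of_rat a + of_rat b * r" "conj z = of_rat a - of_rat b * r" and
    w: "w = of_rat c + of_rat d * r" "conj w = of_rat c - of_rat d * r"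
    using assms by (metis K_cases)
  have "z + w = of_rat (a + c) + of_rat (b + d) * r"
    unfolding z w by (simp add: of_rat_add algebra_simps)
  hence "conj (z + w) = of_rat (a + c) - of_rat (b + d) * r"
    using conj_eq by simp
  thus ?thesis unfolding z(2) w(2) by (simp add: of_rat_add algebra_simps)
qed

lemma conj_mult:
  assumes "z \<in> K" "w \<in> K" shows "conj (z * w) = conj z * conj w"
proof -
  obtain a b c d where
    z: "z = of_rat a + of_rat b * r" "conj z = of_rat a - of_rat b * r" and
    w: "w = of_rat c + of_rat d * r" "conj w = of_rat c - of_rat d * r"
    using assms by (metis K_cases)
  have "z * w = of_rat a * of_rat c + of_rat b * of_rat d * (r * r)
      + (of_rat a * of_rat d + of_rat b * of_rat c) * r"
    unfolding z w by (rule quadratic_mult_expand)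
  also have "\<dots> = of_rat (a * c + b * d * of_int D) + of_rat (a * d + b * c) * r"
    unfolding r_sq by (simp add: of_rat_add of_rat_mult)
  finally have "conj (z * w) = of_rat (a * c + b * d * of_int D) - of_rat (a * d + b * c) * r"
    using conj_eq by metis
  also have "\<dots> = of_rat a * of_rat c + of_rat b * of_rat d * (r * r)
      - (of_rat a * of_rat d + of_rat b * of_rat c) * r"
    unfolding r_sq by (simp add: of_rat_add of_rat_mult)
  also have "\<dots> = conj z * conj w"
    unfolding z(2) w(2) using quadratic_mult_expand[of "of_rat a" "- of_rat b" r "of_rat c" "- of_rat d"]
    by (simp del: real_sqrt_mult_self add: algebra_simps)
  finally show ?thesis .
qed

lemma conj_of_rat: "conj (of_rat x) = of_rat x"
  using conj_eq[of x 0] by simp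

lemma conj_sqrt: "conj r = - r"
  using conj_eq[of 0 1] by simp

lemma conj_power: "z \<in> K \<Longrightarrow> conj (z ^ n) = conj z ^ n"
proof (induction n)
  case 0
  show ?case using conj_of_rat[of 1] by simp
next
  case (Suc n)
  thus ?case using conj_mult quadratic_field_power[of D z n] D_pos by simp
qed

lemma poly_conj:
  assumes "\<forall>i. coeff p i \<in> \<int>" "z \<in> K"
  shows "poly p z \<in> K \<and> conj (poly p z) = poly p (conj z)"
  using assms(1)
proof (induction p)
  case 0
  show ?case using quadratic_field_rat[of 0 D] conj_of_rat[of 0] by simp
next
  case (pCons a p)
  have "a \<in> \<int>" using pCons.prems[rule_format, of 0] by simp
  then obtain k where k: "a = of_int k" by (auto elim: Ints_cases)
  have "\<forall>i. coeff p i \<in> \<int>"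
    using pCons.prems by (metis coeff_pCons_Suc)
  hence IH: "poly p z \<in> K" "conj (poly p z) = poly p (conj z)" using pCons.IH by auto
  have aK: "a \<in> K" "conj a = a"
    using k quadratic_field_of_int[of k D] conj_of_rat[of "of_int k"] by auto
  have "z * poly p z \<in> K"
    using IH assms D_pos by (intro quadratic_field_mult) auto
  thus ?case using IH aK assms by (simp add: conj_add conj_mult quadratic_field_add)
qed

lemma conj_integers:
  assumes "z \<in> integers" shows "conj z \<in> integers"
proof -
  have zK: "z \<in> K" using assms by simp
  obtain p where p: "lead_coeff p = 1" "\<forall>i. coeff p i \<in> \<int>" "poly p z = 0"
    using assms by (auto simp: algebraic_int.simps)
  have "poly p (conj z) = 0"
    using poly_conj[OF p(2) zK] p(3) conj_of_rat[of 0] by simp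
  thus ?thesis using p conj_in_K[OF zK] by (auto intro: algebraic_int.intros)
qed

section \<open>Embeddings and degree\<close>

lemma real_embedding_rat:
  assumes "\<sigma> \<in> ring_hom (real_ring K) (real_ring UNIV)"
  shows "\<sigma> (of_rat q) = of_rat q"
proof -
  have add: "\<sigma> (x + y) = \<sigma> x + \<sigma> y" if "x \<in> K" "y \<in> K" for x y
    using ring_hom_add[OF assms, of x y] that by (simp add: real_ring_def)
  have mult: "\<sigma> (x * y) = \<sigma> x * \<sigma> y" if "x \<in> K" "y \<in> K" for x y
    using ring_hom_mult[OF assms, of x y] that by (simp add: real_ring_def)
  have one: "\<sigma> 1 = 1"
    using ring_hom_one[OF assms] by (simp add: real_ring_def)
  have zeroK: "0 \<in> K" using quadratic_field_rat[of 0 D] by simp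
  have zero: "\<sigma> 0 = 0" using add[OF zeroK zeroK] by simp
  have oneK: "1 \<in> K" using quadratic_field_rat[of 1 D] by simp
  have nat: "\<sigma> (of_nat n) = of_nat n" for n
  proof (induction n)
    case (Suc n)
    have "of_nat n \<in> K" using quadratic_field_of_int[of "int n" D] by simp
    thus ?case using Suc add[OF oneK, of "of_nat n"] one by simp
  qed (simp add: zero)
  have int: "\<sigma> (of_int k) = of_int k" for k
  proof (cases "k \<ge> 0")
    case True
    thus ?thesis using nat[of "nat k"] by simp
  next
    case False
    have "\<sigma> (of_int k) + \<sigma> (of_int (- k)) = \<sigma> (of_int k + of_int (- k))"
      by (rule add[symmetric]) (rule quadratic_field_of_int)+
    also have "\<dots> = 0" using zero by simp
    finally show ?thesis using nat[of "nat (- k)"] False by simp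
  qed
  obtain a b where ab: "q = of_int a / of_int b" "b > 0"
    by (metis quotient_of_div quotient_of_denom_pos surj_pair)
  have "\<sigma> (of_rat q) * \<sigma> (of_int b) = \<sigma> (of_rat q * of_int b)"
    by (rule mult[symmetric]) (rule quadratic_field_rat quadratic_field_of_int)+
  also have q: "of_rat q * of_int b = (of_int a :: real)"
    using ab by (simp add: of_rat_divide)
  finally have "\<sigma> (of_rat q) * of_int b = of_rat q * of_int b"
    using int q by simp
  thus ?thesis using ab(2) by simp
qed

lemma real_embeddings_eq: "real_embeddings K = {restrict id K, restrict conj K}"
proof (intro equalityI subsetI)
  fix \<sigma> assume "\<sigma> \<in> real_embeddings K"
  hence hom: "\<sigma> \<in> ring_hom (real_ring K) (real_ring UNIV)" and ext: "\<sigma> \<in> extensional K"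
    by (auto simp: real_embeddings_def)
  note rat = real_embedding_rat[OF hom]
  have rK: "r \<in> K" by (rule quadratic_field_sqrt)
  have mult: "\<sigma> (x * y) = \<sigma> x * \<sigma> y" if "x \<in> K" "y \<in> K" for x y
    using ring_hom_mult[OF hom, of x y] that by (simp add: real_ring_def)
  have img: "\<sigma> (of_rat x + of_rat y * r) = of_rat x + of_rat y * \<sigma> r" for x y
  proof -
    have "of_rat y * r \<in> K"
      using quadratic_field_mult[OF _ quadratic_field_rat rK] D_pos by simp
    hence "\<sigma> (of_rat x + of_rat y * r) = \<sigma> (of_rat x) + \<sigma> (of_rat y * r)"
      using ring_hom_add[OF hom, of "of_rat x" "of_rat y * r"] quadratic_field_rat
      by (simp add: real_ring_def)
    thus ?thesis using rat mult[OF quadratic_field_rat rK] by simp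
  qed
  have "\<sigma> r * \<sigma> r = \<sigma> (r * r)" using mult[OF rK rK] by simp
  also have "\<dots> = of_int D" unfolding r_sq using rat[of "of_int D"] by simp
  also have "\<dots> = r * r" using r_sq by simp
  finally have "\<sigma> r = r \<or> \<sigma> r = - r"
    using square_eq_iff by blast
  thus "\<sigma> \<in> {restrict id K, restrict conj K}"
  proof
    assume s: "\<sigma> r = r"
    have "\<sigma> = restrict id K"
    proof (rule extensionalityI[OF ext])
      fix z assume "z \<in> K"
      thus "\<sigma> z = restrict id K z"
        using img s by (auto simp: quadratic_field_iff)
    qed auto
    thus ?thesis by simp
  next
    assume s: "\<sigma> r = - r"
    have "\<sigma> = restrict conj K"
    proof (rule extensionalityI[OF ext])
      fix z assume z: "z \<in> K"
      thus "\<sigma> z = restrict conj K z"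
        by (rule K_cases) (use img s z in simp)
    qed auto
    thus ?thesis by simp
  qed
next
  have oneK: "1 \<in> K" using quadratic_field_rat[of 1 D] by simp
  fix \<sigma> assume "\<sigma> \<in> {restrict id K, restrict conj K}"
  then consider "\<sigma> = restrict id K" | "\<sigma> = restrict conj K" by blast
  thus "\<sigma> \<in> real_embeddings K"
  proof cases
    case 1
    thus ?thesis
      using D_pos oneK
      by (auto simp: real_embeddings_def real_ring_def ring_hom_def quadratic_field_add
          quadratic_field_mult)
  next
    case 2
    thus ?thesis
      using D_pos oneK conj_of_rat[of 1]
      by (auto simp: real_embeddings_def real_ring_def ring_hom_def quadratic_field_add
          quadratic_field_mult conj_add conj_mult)
  qed
qed

lemma restrict_id_neq_conj: "restrict id K \<noteq> restrict conj K"
proof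
  assume "restrict id K = restrict conj K"
  hence "r = - r" using quadratic_field_sqrt[of D] conj_sqrt by (metis id_apply restrict_apply')
  thus False using D_pos by simp
qed

lemma field_degree_eq: "field_degree K = 2"
proof -
  interpret V: vector_space "\<lambda>(q::rat) (x::real). of_rat q * x"
    by unfold_locales (simp_all add: of_rat_add of_rat_mult algebra_simps)
  have span_r: "V.span {r} = range (\<lambda>q. of_rat q * r)"
    by (rule V.span_singleton)
  have span: "V.span {1, r} = K"
  proof (rule Set.set_eqI)
    fix z
    have "z \<in> V.span {1, r} \<longleftrightarrow> (\<exists>x y. z - of_rat x = of_rat y * r)"
      by (auto simp: V.span_insert span_r)
    also have "\<dots> \<longleftrightarrow> z \<in> K"
      by (simp add: quadratic_field_iff diff_eq_eq add.commute)
    finally show "z \<in> V.span {1, r} \<longleftrightarrow> z \<in> K" .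
  qed
  have "1 \<notin> V.span {r}"
    unfolding span_r using representation_unique[of 1 0 0] by auto
  moreover have "r \<noteq> 0" using D_pos by simp
  ultimately have "V.independent {1, r}"
    by (metis V.independent_empty V.independent_insert V.span_empty empty_iff singletonD)
  hence "V.dim K = card {1, r}"
    by (rule V.dim_eq_card[rotated]) (simp add: span[symmetric] V.span_span)
  moreover have "r \<noteq> 1" using sqrt_irrational by auto
  ultimately show ?thesis by (simp add: field_degree_def)
qed

end

section \<open>The ring of integers and its residues\<close>

context real_quadratic
begin

lemma R_simps [simp]:
  "carrier R = integers" "x \<otimes>\<^bsub>R\<^esub> y = x * y" "x \<oplus>\<^bsub>R\<^esub> y = x + y" "\<one>\<^bsub>R\<^esub> = 1" "\<zero>\<^bsub>R\<^esub> = 0"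
  by (simp_all add: ring_of_integers_def real_ring_def)

lemma of_int_integers: "of_int m \<in> integers"
  by (simp add: quadratic_field_of_int)

lemma sqrt_integers: "r \<in> integers"
  by (simp add: quadratic_field_sqrt algebraic_int_sqrt)

lemma minus_integers: "x \<in> integers \<Longrightarrow> - x \<in> integers"
  by (simp add: quadratic_field_minus)

lemma ideal_closed:
  assumes "ideal I R"
  shows "I \<subseteq> integers" "0 \<in> I"
    and "x \<in> I \<Longrightarrow> y \<in> I \<Longrightarrow> x + y \<in> I"
    and "x \<in> I \<Longrightarrow> z \<in> integers \<Longrightarrow> z * x \<in> I"
    and "x \<in> I \<Longrightarrow> - x \<in> I"
proof -
  interpret ideal I R by (rule assms)
  show "I \<subseteq> integers" using a_subset by simp
  show "0 \<in> I" using additive_subgroup.zero_closed[OF is_additive_subgroup] by simp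
  show "x \<in> I \<Longrightarrow> y \<in> I \<Longrightarrow> x + y \<in> I"
    using additive_subgroup.a_closed[OF is_additive_subgroup, of x y] by simp
  show mult: "z * x \<in> I" if "x \<in> I" "z \<in> integers" for x z
    using I_l_closed[of x z] that by simp
  show "x \<in> I \<Longrightarrow> - x \<in> I" using mult[of x "-1"] of_int_integers[of "-1"] by simp
qed

end

text \<open>Closure of the algebraic integers of \<open>K\<close> under addition and multiplication is a hypothesis in this
  locale. It costs nothing in what follows: a prime ideal, in the sense of the locale
  \<open>primeideal\<close>, lives in a commutative ring by definition, and statements about all
  prime ideals hold vacuously when there is none.\<close>

locale quadratic_cring = real_quadratic +
  assumes cring: "cring R"
begin

lemma add_integers: "x \<in> integers \<Longrightarrow> y \<in> integers \<Longrightarrow> x + y \<in> integers"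
  using cring.cring_simprules(1)[OF cring, of x y] by simp

lemma mult_integers: "x \<in> integers \<Longrightarrow> y \<in> integers \<Longrightarrow> x * y \<in> integers"
  using cring.cring_simprules(5)[OF cring, of x y] by simp

lemma diff_integers: "x \<in> integers \<Longrightarrow> y \<in> integers \<Longrightarrow> x - y \<in> integers"
  using add_integers[OF _ minus_integers, of x y] by simp

lemma power_integers: "x \<in> integers \<Longrightarrow> x ^ n \<in> integers"
proof (induction n)
  case 0
  show ?case using of_int_integers[of 1] by simp
next
  case (Suc n)
  thus ?case using mult_integers[of x "x ^ n"] by simp
qed

lemma sum_integers: "(\<And>i. i \<in> A \<Longrightarrow> f i \<in> integers) \<Longrightarrow> sum f A \<in> integers"
  using of_int_integers[of 0] add_integers
  by (induction A rule: infinite_finite_induct) auto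

lemma prod_integers: "(\<And>i. i \<in> A \<Longrightarrow> f i \<in> integers) \<Longrightarrow> prod f A \<in> integers"
  using of_int_integers[of 1] mult_integers
  by (induction A rule: infinite_finite_induct) auto

text \<open>The traces of \<open>z\<close> and of \<open>\<surd>D z\<close> are rational algebraic integers, hence integers. This bounds the
  denominators well enough; an integral basis is not needed.\<close>

lemma integer_coordinates:
  assumes "z \<in> integers"
  shows "\<exists>a b::int. z = of_int a / 2 + of_int b / (2 * of_int D) * r"
proof -
  obtain x y where z: "z = of_rat x + of_rat y * r" "conj z = of_rat x - of_rat y * r"
    using assms K_cases by blast
  have "z + conj z \<in> integers"
    by (intro add_integers assms conj_integers)
  moreover have tr: "z + conj z = of_rat (2 * x)"
    unfolding z(2) by (simp add: z(1) of_rat_mult)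
  ultimately have "of_rat (2 * x) \<in> (\<int> :: real set)"
    using rational_algebraic_int_is_int[of "of_rat (2 * x) :: real"] by simp
  then obtain a where a: "(of_rat (2 * x) :: real) = of_int a" by (auto elim: Ints_cases)
  have "r * z + r * conj (- z) \<in> integers"
    by (intro add_integers mult_integers sqrt_integers conj_integers minus_integers assms)
  moreover have "conj (- z) = - conj z"
    using conj_mult[of "-1" z] conj_of_rat[of "-1"] assms quadratic_field_of_int[of "-1" D]
    by (simp add: of_rat_minus)
  ultimately have "r * (z - conj z) \<in> integers" by (simp add: algebra_simps)
  moreover have "r * (z - conj z) = 2 * of_rat y * (r * r)"
    unfolding z(2) by (simp del: real_sqrt_mult_self add: z(1) algebra_simps)
  moreover have "2 * of_rat y * (r * r) = of_rat (2 * y * of_int D)"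
    unfolding r_sq by (simp add: of_rat_mult)
  ultimately have "of_rat (2 * y * of_int D) \<in> (\<int> :: real set)"
    using rational_algebraic_int_is_int[of "of_rat (2 * y * of_int D) :: real"] by simp
  then obtain b where b: "(of_rat (2 * y * of_int D) :: real) = of_int b" by (auto elim: Ints_cases)
  have "of_rat x = (of_int a / 2 :: real)" using a by (simp add: of_rat_mult)
  moreover have "of_rat y = (of_int b / (2 * of_int D) :: real)"
    using b D_pos by (simp add: of_rat_mult field_simps)
  ultimately have "z = of_int a / 2 + of_int b / (2 * of_int D) * r" by (simp add: z(1))
  thus ?thesis by blast
qed

text \<open>There are at most \<open>4 D m\<^sup>2\<close> residue classes modulo \<open>m\<close>. The exact number is \<open>m\<^sup>2\<close>, but the
  constant factor is harmless for the logarithmic estimate in which it is used.\<close>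

lemma residue_map:
  fixes m :: int
  assumes "m > 0"
  obtains \<rho> :: "real \<Rightarrow> int \<times> int"
  where "\<rho> ` integers \<subseteq> {0..<2 * m} \<times> {0..<2 * D * m}"
    and "\<And>z w. z \<in> integers \<Longrightarrow> w \<in> integers \<Longrightarrow> \<rho> z = \<rho> w \<Longrightarrow>
           \<exists>t\<in>integers. z - w = t * of_int m"
proof -
  obtain a b :: "real \<Rightarrow> int" where ab:
    "\<And>z. z \<in> integers \<Longrightarrow> z = of_int (a z) / 2 + of_int (b z) / (2 * of_int D) * r"
    using integer_coordinates by metis
  define \<rho> where "\<rho> z = (a z mod (2 * m), b z mod (2 * D * m))" for z
  show ?thesis
  proof (rule that)
    show "\<rho> ` integers \<subseteq> {0..<2 * m} \<times> {0..<2 * D * m}"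
      using assms D_pos by (auto simp: \<rho>_def)
  next
    fix z w assume zw: "z \<in> integers" "w \<in> integers" "\<rho> z = \<rho> w"
    have "2 * m dvd a z - a w" "2 * D * m dvd b z - b w"
      using zw(3) by (simp_all add: \<rho>_def mod_eq_dvd_iff)
    then obtain k l where kl: "a z - a w = 2 * m * k" "b z - b w = 2 * D * m * l"
      by (auto elim!: dvdE)
    have "z - w = of_int (a z - a w) / 2 + of_int (b z - b w) / (2 * of_int D) * r"
      using ab[OF zw(1)] ab[OF zw(2)] by (simp add: diff_divide_distrib algebra_simps)
    also have "\<dots> = (of_int k + of_int l * r) * of_int m"
      unfolding kl using D_pos by (simp add: algebra_simps)
    finally show "\<exists>t\<in>integers. z - w = t * of_int m"
      using add_integers[OF of_int_integers mult_integers[OF of_int_integers sqrt_integers]]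
      by blast
  qed
qed

end

section \<open>Nonzero prime ideals\<close>

locale quadratic_prime = real_quadratic +
  fixes p :: "real set"
  assumes p: "p \<in> nonzero_primes K"
begin

lemma primeideal: "primeideal p R" and p_nonzero: "p \<noteq> {0}"
  using p by (auto simp: nonzero_primes_def)

sublocale primeideal p R by (rule primeideal)

sublocale quadratic_cring D
  by unfold_locales

lemma p_ideal: "ideal p R" by (rule primeideal.axioms[OF primeideal])

lemmas p_closed = ideal_closed[OF p_ideal]

lemma p_prime: "x \<in> integers \<Longrightarrow> y \<in> integers \<Longrightarrow> x * y \<in> p \<Longrightarrow> x \<in> p \<or> y \<in> p"
  using I_prime[of x y] by simp

lemma one_notin: "1 \<notin> p"
proof
  assume "1 \<in> p"
  hence "integers \<subseteq> p" using p_closed(4)[of 1] by auto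
  thus False using I_notcarr p_closed(1) by auto
qed

lemma p_prime_power: "x \<in> integers \<Longrightarrow> x ^ n \<in> p \<Longrightarrow> x \<in> p"
proof (induction n)
  case (Suc n)
  thus ?case using p_prime[of x "x ^ n"] power_integers by auto
qed (use one_notin in simp)

lemma p_prime_prod:
  assumes "finite A" "\<And>i. i \<in> A \<Longrightarrow> f i \<in> integers" "prod f A \<in> p"
  shows "\<exists>i\<in>A. f i \<in> p"
  using assms
proof (induction A)
  case (insert i A)
  thus ?case using p_prime[of "f i" "prod f A"] prod_integers[of A f] by auto
qed (use one_notin in simp)

text \<open>The norm of a nonzero element is a nonzero integer in the ideal.\<close>

lemma contains_positive_integer: "\<exists>m::int. m > 0 \<and> of_int m \<in> p"
proof -
  obtain z where z: "z \<in> p" "z \<noteq> 0" using p_nonzero p_closed(2) by blast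
  have zi: "z \<in> integers" using z p_closed(1) by blast
  then obtain x y where xy: "z = of_rat x + of_rat y * r" "conj z = of_rat x - of_rat y * r"
    using K_cases by blast
  have "conj z \<noteq> 0"
  proof
    assume "conj z = 0"
    hence "of_rat x + of_rat (- y) * r = of_rat 0 + of_rat 0 * r"
      using xy(2) by (simp add: of_rat_minus)
    hence "x = 0" "- y = 0" using representation_unique by blast+
    thus False using z(2) xy(1) by simp
  qed
  have ci: "conj z \<in> integers" by (rule conj_integers[OF zi])
  have inp: "conj z * z \<in> p" by (rule p_closed(4)[OF z(1) ci])
  have "conj z * z = of_rat x * of_rat x - of_rat y * of_rat y * (r * r)"
    unfolding xy(2) by (simp del: real_sqrt_mult_self add: xy(1) algebra_simps)
  also have "\<dots> = of_rat (x * x - y * y * of_int D)"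
    unfolding r_sq by (simp add: of_rat_mult of_rat_diff)
  finally have "conj z * z \<in> \<int>"
    using rational_algebraic_int_is_int[of "conj z * z"] inp p_closed(1) by auto
  then obtain k where k: "conj z * z = of_int k" by (auto elim: Ints_cases)
  hence "k \<noteq> 0" using \<open>conj z \<noteq> 0\<close> z(2) by auto
  moreover have "of_int k \<in> p" "of_int (- k) \<in> p" using inp k p_closed(5)[OF inp] by auto
  ultimately show ?thesis by (metis neg_0_less_iff_less linorder_neqE)
qed

lemma residue_map_mod:
  obtains \<rho> :: "real \<Rightarrow> int \<times> int"
  where "finite (\<rho> ` integers)"
    and "\<And>z w. z \<in> integers \<Longrightarrow> w \<in> integers \<Longrightarrow> \<rho> z = \<rho> w \<Longrightarrow> z - w \<in> p"
proof -
  obtain m :: int where m: "m > 0" "of_int m \<in> p" using contains_positive_integer by blast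
  obtain \<rho> where \<rho>: "\<rho> ` integers \<subseteq> {0..<2 * m} \<times> {0..<2 * D * m}"
    "\<And>z w. z \<in> integers \<Longrightarrow> w \<in> integers \<Longrightarrow> \<rho> z = \<rho> w \<Longrightarrow>
       \<exists>t\<in>integers. z - w = t * of_int m"
    using residue_map[OF m(1)] by blast
  show ?thesis
  proof (rule that)
    show "finite (\<rho> ` integers)" by (rule finite_subset[OF \<rho>(1)]) simp
    show "z - w \<in> p" if "z \<in> integers" "w \<in> integers" "\<rho> z = \<rho> w" for z w
      using \<rho>(2)[OF that] p_closed(4)[OF m(2)] by auto
  qed
qed

text \<open>Nonzero prime ideals are maximal: among the powers of \<open>d\<close> two are congruent modulo \<open>p\<close>, and
  cancelling the smaller one shows that a positive power of \<open>d\<close> is congruent to \<open>1\<close>.\<close>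

lemma invertible_mod:
  assumes d: "d \<in> integers" "d \<notin> p"
  shows "\<exists>e\<in>integers. 1 - d * e \<in> p"
proof -
  obtain \<rho> :: "real \<Rightarrow> int \<times> int" where \<rho>: "finite (\<rho> ` integers)"
    "\<And>z w. z \<in> integers \<Longrightarrow> w \<in> integers \<Longrightarrow> \<rho> z = \<rho> w \<Longrightarrow> z - w \<in> p"
    using residue_map_mod by blast
  have "finite (range (\<lambda>i. \<rho> (d ^ i)))"
    by (rule finite_subset[OF _ \<rho>(1)]) (use power_integers[OF d(1)] in blast)
  hence "\<not> inj (\<lambda>i::nat. \<rho> (d ^ i))"
    using finite_imageD infinite_UNIV_nat by blast
  then obtain i j :: nat where "i \<noteq> j" "\<rho> (d ^ i) = \<rho> (d ^ j)"
    by (auto simp: inj_def)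
  then obtain i j :: nat where ij: "i < j" "\<rho> (d ^ i) = \<rho> (d ^ j)"
    by (metis linorder_neqE_nat)
  define e where "e = d ^ (j - i - 1)"
  have e: "e \<in> integers" unfolding e_def by (rule power_integers[OF d(1)])
  have "d ^ i * (d * e) = d ^ (i + (1 + (j - i - 1)))"
    unfolding e_def power_add by simp
  also have "i + (1 + (j - i - 1)) = j" using ij(1) by simp
  finally have "d ^ i - d ^ j = d ^ i * (1 - d * e)" by (simp add: algebra_simps)
  moreover have "d ^ i - d ^ j \<in> p"
    by (rule \<rho>(2)[OF power_integers[OF d(1)] power_integers[OF d(1)] ij(2)])
  moreover have "1 - d * e \<in> integers"
    using diff_integers[OF of_int_integers[of 1] mult_integers[OF d(1) e]] by simp
  ultimately have "d ^ i \<in> p \<or> 1 - d * e \<in> p"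
    using p_prime[of "d ^ i" "1 - d * e"] power_integers[OF d(1)] by simp
  thus ?thesis using p_prime_power[OF d(1)] d(2) e by blast
qed

lemma ideal_power: "ideal (p [^]\<^bsub>ideals_set R\<^esub> (n::nat)) R"
proof -
  interpret M: comm_monoid "ideals_set R"
    by (rule cring.ideals_set_is_comm_monoid[OF cring])
  have "p \<in> carrier (ideals_set R)" using p_ideal by (simp add: ideals_set_def)
  hence "p [^]\<^bsub>ideals_set R\<^esub> n \<in> carrier (ideals_set R)" by (rule M.nat_pow_closed)
  thus ?thesis by (simp add: ideals_set_def)
qed

lemma power_in_ideal_power: "z \<in> p \<Longrightarrow> z ^ n \<in> p [^]\<^bsub>ideals_set R\<^esub> n"
proof (induction n)
  case 0
  show ?case
    using of_int_integers[of 1] by (simp add: ideals_set_def)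
next
  case (Suc n)
  have "z ^ n * z \<in> ideal_prod R (p [^]\<^bsub>ideals_set R\<^esub> n) p"
    using ideal_prod.prod[OF Suc.IH[OF Suc.prems] Suc.prems, of R] by simp
  thus ?case by (simp add: ideals_set_def mult.commute)
qed

text \<open>An element outside \<open>p\<close> is invertible modulo \<open>p\<close>, hence modulo every power of \<open>p\<close>: if
  \<open>1 - c d \<in> p\<close>, then \<open>(1 - c d)\<^sup>n\<close> lies in the \<open>n\<close>-th power of \<open>p\<close> and has the form \<open>1 - c w\<close>.\<close>

lemma mult_in_ideal_power_iff:
  assumes c: "c \<in> integers" "c \<notin> p" and y: "y \<in> integers"
  shows "c * y \<in> p [^]\<^bsub>ideals_set R\<^esub> (n::nat) \<longleftrightarrow> y \<in> p [^]\<^bsub>ideals_set R\<^esub> n"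
proof
  note I = ideal_closed[OF ideal_power[of n]]
  show "c * y \<in> p [^]\<^bsub>ideals_set R\<^esub> n" if "y \<in> p [^]\<^bsub>ideals_set R\<^esub> n"
    by (rule I(4)[OF that c(1)])
  assume cy: "c * y \<in> p [^]\<^bsub>ideals_set R\<^esub> n"
  obtain d where d: "d \<in> integers" "1 - c * d \<in> p" using invertible_mod[OF c] by blast
  have ex: "\<exists>w\<in>integers. (1 - c * d) ^ n = 1 - c * w" for n
  proof (induction n)
    case 0
    show ?case using of_int_integers[of 0] by (intro bexI[of _ 0]) auto
  next
    case (Suc n)
    then obtain w where w: "w \<in> integers" "(1 - c * d) ^ n = 1 - c * w" by blast
    have "(1 - c * d) ^ Suc n = 1 - c * (w + d - d * (c * w))"
      unfolding power_Suc w(2) by (simp add: algebra_simps)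
    moreover have "w + d - d * (c * w) \<in> integers"
      by (intro diff_integers add_integers mult_integers w d c)
    ultimately show ?case by blast
  qed
  then obtain w where w: "w \<in> integers" "(1 - c * d) ^ n = 1 - c * w" by blast
  have "y * (1 - c * w) \<in> p [^]\<^bsub>ideals_set R\<^esub> n"
    using I(4)[OF power_in_ideal_power[OF d(2), of n] y] unfolding w(2) .
  moreover have "w * (c * y) \<in> p [^]\<^bsub>ideals_set R\<^esub> n" by (rule I(4)[OF cy w(1)])
  ultimately have "y * (1 - c * w) + w * (c * y) \<in> p [^]\<^bsub>ideals_set R\<^esub> n" by (rule I(3))
  thus "y \<in> p [^]\<^bsub>ideals_set R\<^esub> n" by (simp add: algebra_simps)
qed

text \<open>Whatever fraction \<open>c = a / b\<close> is chosen in the definition of \<open>val\<close>, the elements \<open>a = c b\<close> and \<open>b\<close>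
  lie in the same powers of \<open>p\<close>, so that their values agree. This avoids unique factorisation of
  ideals and additivity of the valuation.\<close>

lemma val_eq_0:
  assumes c: "c \<in> integers" "c \<notin> p"
  shows "val K p c = 0"
proof -
  have c0: "c \<noteq> 0" using c(2) p_closed(2) by auto
  let ?Q = "\<lambda>m. \<exists>a\<in>carrier R. \<exists>b\<in>carrier R.
      a \<noteq> 0 \<and> b \<noteq> 0 \<and> c = a / b \<and> m = int (integral_val K p a) - int (integral_val K p b)"
  have "?Q (int (integral_val K p c) - int (integral_val K p 1))"
    using c c0 of_int_integers[of 1] by (intro bexI[of _ c] bexI[of _ 1]) auto
  hence "?Q (val K p c)" unfolding val_def by (rule someI[of ?Q])
  then obtain a b where ab: "a \<in> integers" "b \<in> integers" "b \<noteq> 0" "c = a / b"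
    "val K p c = int (integral_val K p a) - int (integral_val K p b)" by auto
  have "a = c * b" using ab by simp
  hence "integral_val K p a = integral_val K p b"
    unfolding integral_val_def using mult_in_ideal_power_iff[OF c ab(2)] by simp
  thus ?thesis using ab(5) by simp
qed

end

section \<open>Ideal norms and the Chinese remainder theorem\<close>

context quadratic_prime
begin

text \<open>The residue class of \<open>x\<close> modulo \<open>p\<close> appears as the image of \<open>p\<close> under translation by \<open>x\<close>.\<close>

lemma carrier_Quot: "carrier (R Quot p) = (\<lambda>x. (\<lambda>h. h + x) ` p) ` integers"
  by (auto simp: FactRing_def A_RCOSETS_def' a_r_coset_def')

lemma coset_eq:
  assumes "x - y \<in> p"
  shows "(\<lambda>h. h + x) ` p = (\<lambda>h. h + y) ` p"
proof -
  have sub: "(\<lambda>h. h + x) ` p \<subseteq> (\<lambda>h. h + y) ` p" if "x - y \<in> p" for x y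
  proof
    fix z assume "z \<in> (\<lambda>h. h + x) ` p"
    then obtain h where h: "h \<in> p" "z = h + x" by blast
    hence "z = (h + (x - y)) + y" by simp
    thus "z \<in> (\<lambda>h. h + y) ` p" using p_closed(3)[OF h(1) that] by blast
  qed
  have "y - x \<in> p" using p_closed(5)[OF assms] by simp
  thus ?thesis using sub assms by blast
qed

lemma finite_Quot: "finite (carrier (R Quot p))"
proof -
  obtain \<rho> :: "real \<Rightarrow> int \<times> int" where \<rho>: "finite (\<rho> ` integers)"
    "\<And>z w. z \<in> integers \<Longrightarrow> w \<in> integers \<Longrightarrow> \<rho> z = \<rho> w \<Longrightarrow> z - w \<in> p"
    using residue_map_mod by blast
  define g where "g u = (\<lambda>h. h + (SOME z. z \<in> integers \<and> \<rho> z = u)) ` p" for u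
  have "(\<lambda>h. h + x) ` p = g (\<rho> x)" if x: "x \<in> integers" for x
  proof -
    have "(SOME z. z \<in> integers \<and> \<rho> z = \<rho> x) \<in> integers \<and>
        \<rho> (SOME z. z \<in> integers \<and> \<rho> z = \<rho> x) = \<rho> x"
      by (rule someI[of _ x]) (use x in simp)
    thus ?thesis unfolding g_def by (intro coset_eq \<rho>(2) x) auto
  qed
  hence "carrier (R Quot p) \<subseteq> g ` (\<rho> ` integers)" unfolding carrier_Quot by blast
  thus ?thesis using \<rho>(1) finite_subset by blast
qed

lemma ideal_norm_pos: "ideal_norm K p > 0"
  unfolding ideal_norm_def card_gt_0_iff
  using finite_Quot carrier_Quot of_int_integers[of 0] by blast

lemma int_prime_factor:
  fixes e :: int
  assumes "e \<noteq> 0" "of_int e \<in> p"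
  shows "\<exists>q::nat. Factorial_Ring.prime q \<and> int q dvd e \<and> of_nat q \<in> p"
  using assms
proof (induction "nat \<bar>e\<bar>" arbitrary: e rule: less_induct)
  case less
  show ?case
  proof (cases "\<bar>e\<bar> = 1")
    case True
    hence "e = 1 \<or> e = -1" by linarith
    hence "1 \<in> p" using less.prems(2) p_closed(5)[OF less.prems(2)] by auto
    thus ?thesis using one_notin by simp
  next
    case False
    hence "nat \<bar>e\<bar> \<noteq> 1" by linarith
    then obtain q where q: "Factorial_Ring.prime q" "q dvd nat \<bar>e\<bar>"
      using prime_factor_nat by blast
    hence "int q dvd e" by (simp add: int_dvd_int_iff[symmetric])
    then obtain f where f: "e = int q * f" by (elim dvdE)
    have "f \<noteq> 0" using f less.prems(1) by auto
    have "(of_nat q :: real) \<in> p \<or> of_int f \<in> p"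
      using p_prime[of "of_int (int q)" "of_int f"] of_int_integers[of "int q"]
        of_int_integers[of f] less.prems(2) f by simp
    thus ?thesis
    proof
      assume "of_nat q \<in> p"
      thus ?thesis using q(1) \<open>int q dvd e\<close> by blast
    next
      assume fp: "of_int f \<in> p"
      have "1 < int q" using prime_gt_1_nat[OF q(1)] by simp
      hence "\<bar>f\<bar> < \<bar>e\<bar>" using \<open>f \<noteq> 0\<close> unfolding f abs_mult by simp
      hence "nat \<bar>f\<bar> < nat \<bar>e\<bar>" by simp
      from less.hyps[OF this \<open>f \<noteq> 0\<close> fp] show ?thesis unfolding f by auto
    qed
  qed
qed

lemma unit_notin:
  assumes "u \<in> integers" "v \<in> integers" "u * v = 1 \<or> u * v = - 1"
  shows "u \<notin> p"
proof
  assume "u \<in> p"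
  hence "u * v \<in> p" using p_closed(4)[of u v] assms by (simp add: mult.commute)
  hence "1 \<in> p" using assms(3) p_closed(5)[of "u * v"] by auto
  thus False using one_notin by simp
qed

lemma val_unit_power:
  assumes "u \<in> integers" "v \<in> integers" "u * v = 1 \<or> u * v = - 1"
  shows "val K p (u ^ n) = 0" "val K p (- (u ^ n)) = 0"
proof -
  have np: "u ^ n \<notin> p" using p_prime_power[OF assms(1)] unit_notin[OF assms] by blast
  hence "- (u ^ n) \<notin> p" using p_closed(5)[of "- (u ^ n)"] by auto
  thus "val K p (u ^ n) = 0" "val K p (- (u ^ n)) = 0"
    using np val_eq_0[of "u ^ n"] val_eq_0[of "- (u ^ n)"] power_integers[OF assms(1)]
      minus_integers[of "u ^ n"] by blast+
qed

lemma p_sum: "(\<And>i. i \<in> A \<Longrightarrow> f i \<in> p) \<Longrightarrow> sum f A \<in> p"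
  using p_closed(2) p_closed(3) by (induction A rule: infinite_finite_induct) auto

end

context real_quadratic
begin

lemma prime_of:
  "p \<in> nonzero_primes K \<Longrightarrow> quadratic_prime D p"
  by unfold_locales

lemma nonzero_primes_antichain:
  assumes "p \<in> nonzero_primes K" "q \<in> nonzero_primes K" "q \<subseteq> p"
  shows "q = p"
proof (rule ccontr)
  interpret p: quadratic_prime D p by (rule prime_of) fact
  interpret q: quadratic_prime D q by (rule prime_of) fact
  assume "q \<noteq> p"
  then obtain d where d: "d \<in> p" "d \<notin> q" using assms(3) by blast
  have di: "d \<in> integers" using d(1) p.p_closed(1) by blast
  obtain e where e: "e \<in> integers" "1 - d * e \<in> q" using q.invertible_mod[OF di d(2)] by blast
  have "e * d \<in> p" by (rule p.p_closed(4)[OF d(1) e(1)])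
  hence "(1 - d * e) + e * d \<in> p" using e(2) assms(3) by (intro p.p_closed(3)) auto
  thus False using p.one_notin by (simp add: mult.commute)
qed

lemma chinese_remainder_idempotent:
  assumes F: "finite F" "F \<subseteq> nonzero_primes K" and p: "p \<in> F"
  shows "\<exists>e\<in>integers. e - 1 \<in> p \<and> (\<forall>q\<in>F - {p}. e \<in> q)"
proof -
  interpret p: quadratic_prime D p using F p by (intro prime_of) blast
  have "\<exists>y. y \<in> q \<and> y \<notin> p" if "q \<in> F - {p}" for q
    using nonzero_primes_antichain[of p q] F(2) p that by blast
  then obtain y where y: "\<And>q. q \<in> F - {p} \<Longrightarrow> y q \<in> q \<and> y q \<notin> p" by metis
  have yi: "y q \<in> integers" if "q \<in> F - {p}" for q
  proof -
    interpret q: quadratic_prime D q using F that by (intro prime_of) blast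
    show ?thesis using y[OF that] q.p_closed(1) by blast
  qed
  define Y where "Y = prod y (F - {p})"
  have Yi: "Y \<in> integers" unfolding Y_def by (rule p.prod_integers[OF yi])
  have "Y \<notin> p"
    using p.p_prime_prod[of "F - {p}" y] F(1) yi y unfolding Y_def by blast
  then obtain e where e: "e \<in> integers" "1 - Y * e \<in> p" using p.invertible_mod[OF Yi] by blast
  show ?thesis
  proof (intro bexI conjI ballI)
    show "Y * e \<in> integers" by (rule p.mult_integers[OF Yi e(1)])
    show "Y * e - 1 \<in> p" using p.p_closed(5)[OF e(2)] by simp
    fix q assume q: "q \<in> F - {p}"
    interpret q: quadratic_prime D q using F q by (intro prime_of) blast
    have "Y = y q * prod y (F - {p} - {q})"
      unfolding Y_def using F(1) q by (intro prod.remove) auto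
    hence "Y * e = (prod y (F - {p} - {q}) * e) * y q" by simp
    also have "\<dots> \<in> q"
      using y[OF q] yi by (intro q.p_closed(4) p.mult_integers p.prod_integers e(1)) auto
    finally show "Y * e \<in> q" .
  qed
qed

lemma chinese_remainder:
  assumes F: "finite F" "F \<subseteq> nonzero_primes K" and f: "\<And>p. p \<in> F \<Longrightarrow> f p \<in> integers"
  shows "\<exists>x\<in>integers. \<forall>p\<in>F. x - f p \<in> p"
proof (cases "F = {}")
  case True
  thus ?thesis using of_int_integers[of 0] by blast
next
  case False
  then obtain p0 where "p0 \<in> F" by blast
  then interpret p0: quadratic_prime D p0 using F by (intro prime_of) blast
  obtain e where e: "\<And>p. p \<in> F \<Longrightarrow> e p \<in> integers \<and> e p - 1 \<in> p \<and> (\<forall>q\<in>F - {p}. e p \<in> q)"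
    using chinese_remainder_idempotent[OF F] by metis
  show ?thesis
  proof (intro bexI ballI)
    show "(\<Sum>p\<in>F. e p * f p) \<in> integers"
      using e f by (intro p0.sum_integers p0.mult_integers) auto
    fix q assume q: "q \<in> F"
    interpret q: quadratic_prime D q using F q by (intro prime_of) blast
    have "(\<Sum>p\<in>F. e p * f p) - f q = (\<Sum>p\<in>F - {q}. e p * f p) + f q * (e q - 1)"
      using F(1) q by (simp add: sum.remove algebra_simps)
    also have "\<dots> \<in> q"
    proof (intro q.p_closed(3) q.p_sum)
      show "f q * (e q - 1) \<in> q" using e[OF q] f[OF q] by (intro q.p_closed(4)) auto
      fix p assume "p \<in> F - {q}"
      hence "f p * e p \<in> q" using e[of p] f[of p] q by (intro q.p_closed(4)) auto
      thus "e p * f p \<in> q" by (simp add: mult.commute)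
    qed
    finally show "(\<Sum>p\<in>F. e p * f p) - f q \<in> q" .
  qed
qed

text \<open>By the Chinese remainder theorem a family of residue classes modulo the \<open>p \<in> F\<close> is realised by one
  integer of \<open>K\<close>, whose class modulo \<open>m\<close> determines the family. So the product of the norms is at
  most the number of residues modulo \<open>m\<close>.\<close>

lemma prod_ideal_norm_le:
  fixes m :: int
  assumes F: "finite F" "F \<subseteq> nonzero_primes K" and m: "m > 0" "\<And>p. p \<in> F \<Longrightarrow> of_int m \<in> p"
  shows "(\<Prod>p\<in>F. ideal_norm K p) \<le> nat (4 * D * m\<^sup>2)"
proof (cases "F = {}")
  case True
  have "1 * 1 * 1 \<le> 4 * D * m\<^sup>2" using D_pos m(1) by (intro mult_mono) auto
  thus ?thesis using True by simp
next
  case False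
  then obtain p0 where "p0 \<in> F" by blast
  then interpret p0: quadratic_prime D p0 using F by (intro prime_of) blast
  let ?B = "{0..<2 * m} \<times> {0..<2 * D * m}"
  obtain \<rho> where \<rho>: "\<rho> ` integers \<subseteq> ?B"
    "\<And>z w. z \<in> integers \<Longrightarrow> w \<in> integers \<Longrightarrow> \<rho> z = \<rho> w \<Longrightarrow>
       \<exists>t\<in>integers. z - w = t * of_int m"
    using p0.residue_map[OF m(1)] by blast
  let ?X = "PiE F (\<lambda>p. carrier (R Quot p))"
  have "\<exists>x\<in>integers. \<forall>p\<in>F. f p = (\<lambda>h. h + x) ` p" if f: "f \<in> ?X" for f
  proof -
    have "\<exists>y\<in>integers. f p = (\<lambda>h. h + y) ` p" if p: "p \<in> F" for p
    proof -
      interpret p: quadratic_prime D p using F p by (intro prime_of) blast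
      have "f p \<in> carrier (R Quot p)" using f p by blast
      thus ?thesis unfolding p.carrier_Quot by blast
    qed
    then obtain y where y: "\<And>p. p \<in> F \<Longrightarrow> y p \<in> integers \<and> f p = (\<lambda>h. h + y p) ` p"
      by metis
    then obtain x where x: "x \<in> integers" "\<forall>p\<in>F. x - y p \<in> p"
      using chinese_remainder[OF F, of y] by blast
    have "f p = (\<lambda>h. h + x) ` p" if p: "p \<in> F" for p
    proof -
      interpret p: quadratic_prime D p using F p by (intro prime_of) blast
      show ?thesis using p.coset_eq[of x "y p"] x(2) p y[OF p] by simp
    qed
    thus ?thesis using x(1) by blast
  qed
  then obtain X where X:
    "\<And>f. f \<in> ?X \<Longrightarrow> X f \<in> integers \<and> (\<forall>p\<in>F. f p = (\<lambda>h. h + X f) ` p)"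
    by metis
  have inj: "inj_on (\<lambda>f. \<rho> (X f)) ?X"
  proof (rule inj_onI)
    fix f g assume fg: "f \<in> ?X" "g \<in> ?X" "\<rho> (X f) = \<rho> (X g)"
    obtain t where t: "t \<in> integers" "X f - X g = t * of_int m"
      using \<rho>(2)[of "X f" "X g"] X fg by blast
    show "f = g"
    proof (rule PiE_ext[OF fg(1,2)])
      fix p assume p: "p \<in> F"
      interpret p: quadratic_prime D p using F p by (intro prime_of) blast
      have "X f - X g \<in> p" unfolding t(2) by (rule p.p_closed(4)[OF m(2)[OF p] t(1)])
      thus "f p = g p" using p.coset_eq[of "X f" "X g"] X[OF fg(1)] X[OF fg(2)] p by simp
    qed
  qed
  have img: "(\<lambda>f. \<rho> (X f)) ` ?X \<subseteq> ?B" using X \<rho>(1) by blast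
  have "(\<Prod>p\<in>F. ideal_norm K p) = card ?X"
    using F(1) by (simp add: card_PiE ideal_norm_def)
  also have "\<dots> \<le> card ?B" by (rule card_inj_on_le[OF inj img]) simp
  also have "\<dots> = nat (2 * m) * nat (2 * D * m)" by (simp add: card_cartesian_product)
  also have "\<dots> = nat (4 * D * m\<^sup>2)"
    using m(1) D_pos by (simp add: nat_mult_distrib[symmetric] power2_eq_square algebra_simps)
  finally show ?thesis .
qed

text \<open>For infinite \<open>F\<close> the sum is \<open>0\<close> by convention, and the bound holds because its right-hand side is
  nonnegative.\<close>

lemma sum_ln_ideal_norm_le:
  fixes m :: int
  assumes F: "F \<subseteq> nonzero_primes K" and m: "m > 0" "\<And>p. p \<in> F \<Longrightarrow> of_int m \<in> p"
  shows "(\<Sum>p\<in>F. ln (real (ideal_norm K p))) \<le> ln (4 * of_int D * (of_int m)\<^sup>2)"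
proof (cases "finite F")
  case True
  have pos: "ideal_norm K p > 0" if "p \<in> F" for p
    using quadratic_prime.ideal_norm_pos[OF prime_of] F that by blast
  have "(\<Sum>p\<in>F. ln (real (ideal_norm K p))) = ln (real (\<Prod>p\<in>F. ideal_norm K p))"
    using ln_prod[OF True, of "\<lambda>p. real (ideal_norm K p)"] pos by simp
  also have "\<dots> \<le> ln (real (nat (4 * D * m\<^sup>2)))"
    using prod_ideal_norm_le[OF True F m] pos
    by (intro ln_mono) (auto intro!: prod_pos simp del: of_nat_prod)
  also have "real (nat (4 * D * m\<^sup>2)) = 4 * of_int D * (of_int m)\<^sup>2"
    using D_pos by simp
  finally show ?thesis .
next
  case False
  have "1 * 1 * 1 \<le> 4 * D * m\<^sup>2" using D_pos m(1) by (intro mult_mono) auto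
  hence "(1::real) \<le> of_int (4 * D * m\<^sup>2)" by linarith
  thus ?thesis using False by simp
qed

section \<open>Bounds for radical and height\<close>

lemma rad_le:
  fixes m :: int
  assumes "m > 0" "\<And>p. p \<in> rad_primes K a b c \<Longrightarrow> of_int m \<in> p"
  shows "rad K a b c \<le> ln (4 * of_int D * (of_int m)\<^sup>2) / 2"
  using sum_ln_ideal_norm_le[of "rad_primes K a b c" m] assms
  by (auto simp: rad_def field_degree_eq rad_primes_def)

text \<open>Only the two archimedean places are used: each finite place contributes a nonnegative term, because
  one of the three absolute values there is \<open>1\<close>. The infinite sum is nonnegative even without
  knowing that it converges.\<close>

lemma height_ge:
  assumes "A > 0" "a \<in> K" "b \<in> K" "c \<in> K"
    and "A \<le> max \<bar>a\<bar> \<bar>b\<bar>" "A \<le> max \<bar>conj a\<bar> \<bar>conj b\<bar>"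
    and "\<And>p. p \<in> nonzero_primes K \<Longrightarrow> val K p a = 0"
  shows "ln A \<le> height K a b c"
proof -
  have arch: "ln A \<le> ln (Max {\<bar>x\<bar>, \<bar>y\<bar>, \<bar>z\<bar>})" if "A \<le> max \<bar>x\<bar> \<bar>y\<bar>" for x y z
    using that assms(1) by (intro ln_mono) (auto simp: max_def split: if_splits)
  have "0 \<le> (\<Sum>\<^sub>\<infinity>p\<in>nonzero_primes K.
      ln (Max {abs_prime K p a, abs_prime K p b, abs_prime K p c}))"
  proof (rule infsum_nonneg)
    fix p assume "p \<in> nonzero_primes K"
    hence "abs_prime K p a = 1" using assms(7) by (simp add: abs_prime_def)
    thus "0 \<le> ln (Max {abs_prime K p a, abs_prime K p b, abs_prime K p c})"
      by (intro ln_ge_zero) simp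
  qed
  moreover have "2 * ln A \<le>
      (\<Sum>\<sigma>\<in>real_embeddings K. ln (Max {\<bar>\<sigma> a\<bar>, \<bar>\<sigma> b\<bar>, \<bar>\<sigma> c\<bar>}))"
    using arch[OF assms(5), of c] arch[OF assms(6), of "conj c"] restrict_id_neq_conj assms(2-4)
    unfolding real_embeddings_eq by (simp del: Max_insert)
  ultimately show ?thesis by (simp add: height_def field_degree_eq del: Max_insert)
qed

end

section \<open>Lucas sequences\<close>

lemma nondegenerate_imp_nonsquare:
  fixes P Q :: int
  assumes Q: "Q = 1 \<or> Q = -1" and D: "P ^ 2 + 4 * Q > 0" and nd: "lucas_nondegenerate P Q"
  shows "P \<noteq> 0" and "sqrt (of_int (P ^ 2 + 4 * Q)) \<notin> \<rat>"
proof -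
  show P0: "P \<noteq> 0"
  proof
    assume P: "P = 0"
    hence "Q = 1" using Q D by auto
    hence "[:- of_int Q, - of_int P, 1:] = [:- 1, 1:] * [:- (- 1), 1 :: complex:]"
      using P by simp
    hence "\<not> (\<exists>m::nat. m > 0 \<and> (1 / (- 1) :: complex) ^ m = 1)"
      using nd unfolding lucas_nondegenerate_def by blast
    moreover have "(1 / (- 1) :: complex) ^ 2 = 1" by simp
    ultimately show False by (metis zero_less_numeral)
  qed
  show "sqrt (of_int (P ^ 2 + 4 * Q)) \<notin> \<rat>"
  proof
    assume "sqrt (of_int (P ^ 2 + 4 * Q)) \<in> \<rat>"
    hence "sqrt (of_int (P ^ 2 + 4 * Q)) \<in> \<int>"
      by (intro rational_algebraic_int_is_int algebraic_int_sqrt algebraic_int_of_int)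
    then obtain t where t: "sqrt (of_int (P ^ 2 + 4 * Q)) = of_int t" by (auto elim: Ints_cases)
    have "real_of_int (t * t) = sqrt (of_int (P ^ 2 + 4 * Q)) * sqrt (of_int (P ^ 2 + 4 * Q))"
      unfolding t by simp
    also have "\<dots> = of_int (P ^ 2 + 4 * Q)"
      using D by (metis abs_of_pos of_int_0_less_iff real_sqrt_mult_self)
    finally have tt: "t * t = P ^ 2 + 4 * Q" by linarith
    have "sqrt (of_int (P ^ 2 + 4 * Q)) > 0" using D by (intro real_sqrt_gt_zero) linarith
    hence tpos: "t > 0" unfolding t by simp
    define a where "a = \<bar>P\<bar>"
    have a: "a \<ge> 1" "t * t = a * a + 4 * Q"
      using P0 tt by (auto simp: a_def power2_eq_square)
    \<comment> \<open>\<open>t\<close> and \<open>a\<close> have the same parity, and \<open>t - a = 2 k\<close> gives \<open>k (k + a) = Q\<close>, a unit; then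
      \<open>k = -1\<close> and \<open>a = 2\<close>, so \<open>t = 0\<close>\<close>
    have eq: "(t - a) * (t + a) = 4 * Q" using a(2) by (simp add: algebra_simps)
    have par: "even (t - a)"
    proof -
      have "even (t * t) \<longleftrightarrow> even (a * a)" using a(2) by simp
      thus ?thesis by simp
    qed
    then obtain k where k: "t - a = 2 * k" by (elim evenE)
    have "k * (t + a) = 2 * Q" using eq k by simp
    moreover have "t + a = 2 * (k + a)" using k by simp
    ultimately have "2 * (k * (k + a)) = 2 * Q" by (simp add: algebra_simps)
    hence "k * (k + a) = Q" by linarith
    hence "\<bar>k\<bar> * \<bar>k + a\<bar> = 1" using Q by (metis abs_1 abs_minus abs_mult)
    hence "\<bar>k\<bar> = 1" "\<bar>k + a\<bar> = 1" by (auto simp: zmult_eq_1_iff)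
    thus False using k a(1) tpos by linarith
  qed
qed

lemma lucas_U_binet:
  fixes \<alpha> \<beta> :: "'a::comm_ring_1"
  assumes "\<alpha> + \<beta> = of_int P" "\<alpha> * \<beta> = - of_int Q"
  shows "\<alpha> ^ n - \<beta> ^ n = (\<alpha> - \<beta>) * of_int (lucas_U P Q n)"
  using assms
proof (induction P Q n rule: lucas_U.induct)
  case (3 P Q n)
  have "\<alpha> ^ Suc (Suc n) - \<beta> ^ Suc (Suc n) =
      (\<alpha> + \<beta>) * (\<alpha> ^ Suc n - \<beta> ^ Suc n) - \<alpha> * \<beta> * (\<alpha> ^ n - \<beta> ^ n)"
    by (simp add: algebra_simps)
  also have "\<dots> = of_int P * ((\<alpha> - \<beta>) * of_int (lucas_U P Q (Suc n)))
      + of_int Q * ((\<alpha> - \<beta>) * of_int (lucas_U P Q n))"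
    unfolding "3.IH"(1)[OF "3.prems"] "3.IH"(2)[OF "3.prems"] "3.prems" by simp
  also have "\<dots> = (\<alpha> - \<beta>) * of_int (lucas_U P Q (Suc (Suc n)))"
    by (simp add: algebra_simps)
  finally show ?case .
qed simp_all

section \<open>Finiteness\<close>

theorem theorem7p2:
  fixes P Q :: int and k :: nat and S :: "nat set"
  assumes "Q = 1 \<or> Q = -1"
    and "P ^ 2 + 4 * Q > 0"
    and "lucas_nondegenerate P Q"
    and "k \<ge> 2"
    and "abc_conjecture (quadratic_field (P ^ 2 + 4 * Q))"
    and "finite S"
    and "\<forall>p\<in>S. Factorial_Ring.prime p"
  shows "finite {n::nat. n > 0 \<and>
           (\<exists>s e :: int. s \<ge> 1 \<and> kth_power_free k e \<and> Supp e \<subseteq> S \<and> lucas_U P Q n = e * s ^ k)}"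
proof -
  define D where "D = P ^ 2 + 4 * Q"
  interpret real_quadratic D
    using nondegenerate_imp_nonsquare[OF assms(1-3)] assms(2)
    by unfold_locales (simp_all add: D_def)
  define \<alpha> \<beta> where "\<alpha> = (of_int P + r) / 2" and "\<beta> = (of_int P - r) / 2"
  have sum: "\<alpha> + \<beta> = of_int P" and diff: "\<alpha> - \<beta> = r"
    by (simp_all add: \<alpha>_def \<beta>_def field_simps)
  have "\<alpha> * \<beta> = (of_int P * of_int P - r * r) / 4"
    unfolding \<alpha>_def \<beta>_def by (simp del: real_sqrt_mult_self add: field_simps)
  also have "\<dots> = - of_int Q"
    unfolding r_sq by (simp add: D_def power2_eq_square)
  finally have prod: "\<alpha> * \<beta> = - of_int Q" .
  have alg: "algebraic_int x" if "x = \<alpha> \<or> x = \<beta>" for x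
  proof (rule algebraic_int.intros)
    have "poly [:- of_int Q, - of_int P, 1:] x = x * x - (\<alpha> + \<beta>) * x + \<alpha> * \<beta>"
      unfolding sum prod by (simp add: algebra_simps)
    also have "\<dots> = (x - \<alpha>) * (x - \<beta>)" by (simp add: algebra_simps)
    finally show "poly [:- of_int Q, - of_int P, 1:] x = 0" using that by auto
  qed (auto simp: coeff_pCons split: nat.splits)
  have \<alpha>_rep: "\<alpha> = of_rat (of_int P / 2) + of_rat (1 / 2) * r"
    and \<beta>_rep: "\<beta> = of_rat (of_int P / 2) + of_rat (- 1 / 2) * r"
    by (simp_all add: \<alpha>_def \<beta>_def of_rat_divide of_rat_minus field_simps)
  have \<alpha>K: "\<alpha> \<in> K" and \<beta>K: "\<beta> \<in> K"
    unfolding quadratic_field_iff using \<alpha>_rep \<beta>_rep by blast+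
  have \<alpha>i: "\<alpha> \<in> integers" and \<beta>i: "\<beta> \<in> integers"
    using alg \<alpha>K \<beta>K by blast+
  have conj_\<alpha>: "conj \<alpha> = \<beta>"
    using conj_eq[of "of_int P / 2" "1 / 2"] \<alpha>_rep \<beta>_rep by (simp add: of_rat_minus of_rat_divide)
  have conj_\<beta>: "conj \<beta> = \<alpha>"
    using conj_eq[of "of_int P / 2" "- 1 / 2"] \<alpha>_rep \<beta>_rep by (simp add: of_rat_minus of_rat_divide)
  have unit: "\<alpha> * \<beta> = 1 \<or> \<alpha> * \<beta> = - 1" using prod assms(1) by auto
  have nz: "\<alpha> \<noteq> 0" "\<beta> \<noteq> 0" using unit by auto
  have r1: "r \<ge> 1" using D_pos by simp
  define A where "A = max \<bar>\<alpha>\<bar> \<bar>\<beta>\<bar>"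
  have A1: "A > 1"
  proof (rule ccontr)
    assume "\<not> A > 1"
    hence le: "\<bar>\<alpha>\<bar> \<le> 1" "\<bar>\<beta>\<bar> \<le> 1" by (auto simp: A_def)
    have ab: "\<bar>\<alpha>\<bar> * \<bar>\<beta>\<bar> = 1" using unit by (auto simp: abs_mult[symmetric])
    have "\<bar>\<alpha>\<bar> = 1" "\<bar>\<beta>\<bar> = 1"
      using mult_left_le[OF le(2), of "\<bar>\<alpha>\<bar>"] mult_left_le[OF le(1), of "\<bar>\<beta>\<bar>"] ab le
      by (auto simp: mult.commute)
    hence "\<alpha> = \<beta> \<or> \<alpha> + \<beta> = 0" by (auto simp: abs_if split: if_splits)
    thus False using sum diff r1 nondegenerate_imp_nonsquare(1)[OF assms(1-3)] by auto
  qed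
  have A_pow: "A ^ n \<le> max \<bar>\<alpha> ^ n\<bar> \<bar>\<beta> ^ n\<bar>" for n
    by (auto simp: A_def max_def power_abs)
  \<comment> \<open>Any \<open>\<epsilon>\<close> with \<open>(1 + \<epsilon>) / 2 < 1\<close> would do; \<open>\<epsilon> = 1/2\<close> leaves \<open>3/4\<close> below.\<close>
  obtain C where C: "\<And>a b c. a \<in> K \<Longrightarrow> b \<in> K \<Longrightarrow> c \<in> K \<Longrightarrow> a \<noteq> 0 \<Longrightarrow> b \<noteq> 0 \<Longrightarrow> c \<noteq> 0 \<Longrightarrow>
      a + b = c \<Longrightarrow> height K a b c \<le> (1 + 1 / 2) * rad K a b c + C"
    using assms(5) unfolding abc_conjecture_def D_def[symmetric]
    by (metis half_gt_zero zero_less_one)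
  define S1 where "S1 = (\<Prod>q\<in>S. int q)"
  have S1: "S1 > 0"
    unfolding S1_def using assms(7) by (intro prod_pos) (auto simp: prime_gt_0_nat)
  \<comment> \<open>\<open>E\<close> comes from \<open>4 D m\<^sup>2\<close> with \<open>m = D S1 s\<close> and \<open>s\<^sup>2 \<le> 2 A\<^sup>n\<close>.\<close>
  define E where "E = ln (8 * real_of_int (D ^ 3 * S1\<^sup>2))"
  define B where "B = (3 / 4 * E + C) * 4 / ln A"
  have "real n \<le> B" if n: "s \<ge> 1" "e \<noteq> 0" "Supp e \<subseteq> S" "lucas_U P Q n = e * s ^ k"
    for n and s e :: int
  proof -
    define U where "U = lucas_U P Q n"
    define c where "c = r * of_int U"
    have U0: "U \<noteq> 0" using n by (simp add: U_def)
    have binet: "\<alpha> ^ n + - (\<beta> ^ n) = c"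
      using lucas_U_binet[OF sum prod, of n] diff by (simp add: c_def U_def)
    define m where "m = D * S1 * s"
    have m: "m > 0" using D_pos S1 n(1) by (simp add: m_def)
    have \<alpha>nK: "\<alpha> ^ n \<in> K" and \<beta>nK: "\<beta> ^ n \<in> K"
      using D_pos \<alpha>K \<beta>K by (auto intro: quadratic_field_power)
    have cK: "c \<in> K"
      using binet quadratic_field_add[OF \<alpha>nK quadratic_field_minus[OF \<beta>nK]] by simp
    \<comment> \<open>\<open>\<alpha>\<close> and \<open>\<beta>\<close> are units, so such a prime ideal contains \<open>c = \<surd>D e s\<^sup>k\<close>,
      hence \<open>\<surd>D\<close>, \<open>e\<close> or \<open>s\<close>; in each case it contains a divisor of \<open>m\<close>.\<close>
    have m_in: "of_int m \<in> p" if "p \<in> rad_primes K (\<alpha> ^ n) (- (\<beta> ^ n)) c" for p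
    proof -
      interpret p: quadratic_prime D p
        using that by (intro prime_of) (simp add: rad_primes_def)
      have "val K p c \<noteq> 0"
        using that p.val_unit_power[OF \<alpha>i \<beta>i unit] p.val_unit_power[OF \<beta>i \<alpha>i] unit
        by (auto simp: rad_primes_def mult.commute)
      moreover have ci: "c \<in> integers"
        unfolding c_def by (rule p.mult_integers[OF sqrt_integers of_int_integers])
      ultimately have "c \<in> p" using p.val_eq_0 by blast
      hence "r \<in> p \<or> of_int U \<in> p"
        unfolding c_def by (rule p.p_prime[OF sqrt_integers of_int_integers])
      moreover have "of_int U = of_int e * (of_int s :: real) ^ k"
        using n(4) by (simp add: U_def)
      ultimately have "r \<in> p \<or> of_int e \<in> p \<or> of_int s \<in> p"
        using p.p_prime[OF of_int_integers p.power_integers[OF of_int_integers]]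
          p.p_prime_power[OF of_int_integers] by metis
      then obtain d where d: "of_int d \<in> p" "d dvd m"
      proof (elim disjE)
        assume "r \<in> p"
        hence "of_int D \<in> p" using p.p_closed(4)[OF _ sqrt_integers] r_sq by metis
        thus ?thesis using that[of D] by (simp add: m_def)
      next
        assume "of_int e \<in> p"
        then obtain q :: nat where q: "Factorial_Ring.prime q" "int q dvd e" "of_nat q \<in> p"
          using p.int_prime_factor[OF n(2)] by blast
        hence "q \<in> S" using n(3) by (auto simp: Supp_def)
        hence "int q dvd S1" unfolding S1_def using assms(6) by (intro dvd_prodI)
        thus ?thesis using that[of "int q"] q(3) by (simp add: m_def)
      next
        assume "of_int s \<in> p"
        thus ?thesis using that[of s] by (simp add: m_def)
      qed
      obtain f where "m = d * f" using d(2) by (elim dvdE)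
      hence "of_int m = (of_int f * of_int d :: real)" by simp
      thus ?thesis using p.p_closed(4)[OF d(1) of_int_integers] by metis
    qed
    have conj_b: "conj (- (\<beta> ^ n)) = - (\<alpha> ^ n)"
      using conj_mult[OF quadratic_field_of_int[of "-1"] \<beta>nK] conj_of_rat[of "-1"]
        conj_power[OF \<beta>K] conj_\<beta> by (simp add: of_rat_minus)
    have "ln (A ^ n) \<le> height K (\<alpha> ^ n) (- (\<beta> ^ n)) c"
    proof (rule height_ge)
      show "0 < A ^ n" using A1 by simp
      show "- (\<beta> ^ n) \<in> K" by (rule quadratic_field_minus[OF \<beta>nK])
      show "A ^ n \<le> max \<bar>\<alpha> ^ n\<bar> \<bar>- (\<beta> ^ n)\<bar>" using A_pow[of n] by simp
      show "A ^ n \<le> max \<bar>conj (\<alpha> ^ n)\<bar> \<bar>conj (- (\<beta> ^ n))\<bar>"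
        using A_pow[of n] conj_power[OF \<alpha>K] conj_\<alpha> conj_b by (simp add: max.commute)
      show "val K p (\<alpha> ^ n) = 0" if "p \<in> nonzero_primes K" for p
        by (rule quadratic_prime.val_unit_power[OF prime_of[OF that] \<alpha>i \<beta>i unit])
    qed (fact \<alpha>nK cK)+
    also have "\<dots> \<le> (1 + 1 / 2) * rad K (\<alpha> ^ n) (- (\<beta> ^ n)) c + C"
      using C[OF \<alpha>nK quadratic_field_minus[OF \<beta>nK] cK] binet nz U0 r1 by (simp add: c_def)
    also have "rad K (\<alpha> ^ n) (- (\<beta> ^ n)) c \<le> ln (4 * of_int D * (of_int m)\<^sup>2) / 2"
      by (rule rad_le[OF m m_in])
    finally have main: "n * ln A \<le> 3 / 4 * ln (4 * of_int D * (of_int m)\<^sup>2) + C"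
      using A1 by (simp add: ln_realpow)
    have "s\<^sup>2 \<le> s ^ k" using n(1) assms(4) by (intro power_increasing) auto
    also have "\<dots> \<le> \<bar>e\<bar> * s ^ k" using n(1,2) by (simp add: mult_le_cancel_right1)
    also have "\<dots> = \<bar>U\<bar>" using n(1,4) by (simp add: U_def abs_mult)
    finally have "real_of_int (s\<^sup>2) \<le> of_int \<bar>U\<bar>" by linarith
    also have "\<dots> \<le> \<bar>c\<bar>" using r1 U0 by (simp add: c_def abs_mult)
    also have "\<dots> \<le> \<bar>\<alpha> ^ n\<bar> + \<bar>\<beta> ^ n\<bar>" using binet by linarith
    also have "\<dots> \<le> A ^ n + A ^ n"
      by (intro add_mono) (auto simp: power_abs A_def intro!: power_mono)
    finally have s2: "real_of_int (s\<^sup>2) \<le> 2 * A ^ n" by simp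
    have "4 * of_int D * (of_int m)\<^sup>2 = 4 * real_of_int (D ^ 3 * S1\<^sup>2) * of_int (s\<^sup>2)"
      by (simp add: m_def power2_eq_square power3_eq_cube)
    also have "\<dots> \<le> 4 * real_of_int (D ^ 3 * S1\<^sup>2) * (2 * A ^ n)"
      using s2 D_pos by (intro mult_left_mono) auto
    finally have "ln (4 * of_int D * (of_int m)\<^sup>2) \<le> ln (8 * real_of_int (D ^ 3 * S1\<^sup>2) * A ^ n)"
      using m D_pos by (intro ln_mono) auto
    also have "\<dots> = E + n * ln A"
      unfolding E_def using A1 D_pos S1 by (subst ln_mult_pos) (auto simp: ln_realpow)
    finally have "n * ln A / 4 \<le> 3 / 4 * E + C" using main by linarith
    thus ?thesis using A1 by (simp add: B_def field_simps)
  qed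
  hence "{n::nat. n > 0 \<and>
      (\<exists>s e :: int. s \<ge> 1 \<and> kth_power_free k e \<and> Supp e \<subseteq> S \<and> lucas_U P Q n = e * s ^ k)}
    \<subseteq> {n. real n \<le> B}"
    by (auto simp: kth_power_free_def)
  moreover have "finite {n. real n \<le> B}"
    by (rule finite_subset[of _ "{..nat \<lfloor>B\<rfloor>}"]) (auto simp: le_nat_floor)
  ultimately show ?thesis by (rule finite_subset)
qed

end
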